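(* Every quasi-Polish space is a convergent approximation space.
   Context: A quasi-metric on a set $E$ is a map $d:E^2\to[0,+\infty)$ with $x=y\iff d(x,y)=d(y,x)=0$ and $d(x,z)\le d(x,y)+d(y,z)$; its topology is generated by the open balls $\{y: d(x,y)<r\}$. A sequence $(x_n)$ is Cauchy if $\lim_n\sup_{p\ge n}d(x_n,x_p)=0$; $(E,d)$ is complete if every Cauchy sequence converges for the metric $\hat d(x,y)=\max(d(x,y),d(y,x))$. A quasi-Polish space is a topological space with a countable basis whose topology is induced by a complete quasi-metric. Approximation relation: a binary relation $\ll$ on a topological basis $\mathcal{B}$ such that for all $U,V,T\in\mathcal{B}$: (1) $U\ll V\Rightarrow V\subseteq U$; (2) $U\subseteq T$ and $U\ll V$ imply $T\ll V$; (3) for every $x\in U$ there is $W\in\mathcal{B}$ with $x\in W$ and $U\ll W$; (4$^+$) every sequence $(U_i)_{i\in\mathbb{N}}$ in $\mathcal{B}$ with $U_i\ll U_{i+1}$ for all $i$ is a neighborhood basis of some point $x\in\bigcap_i U_i$. A convergent approximation space is a space admitting such a relation (conditions (1),(2),(3),(4$^+$)). *)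

theory Defs
  imports "HOL-Analysis.Analysis"
begin

definition quasi_metric :: "'a set \<Rightarrow> ('a \<Rightarrow> 'a \<Rightarrow> real) \<Rightarrow> bool" where
  "quasi_metric E d \<longleftrightarrow>
     (\<forall>x\<in>E. \<forall>y\<in>E. 0 \<le> d x y) \<and>
     (\<forall>x\<in>E. \<forall>y\<in>E. x = y \<longleftrightarrow> (d x y = 0 \<and> d y x = 0)) \<and>
     (\<forall>x\<in>E. \<forall>y\<in>E. \<forall>z\<in>E. d x z \<le> d x y + d y z)"

definition qball :: "'a set \<Rightarrow> ('a \<Rightarrow> 'a \<Rightarrow> real) \<Rightarrow> 'a \<Rightarrow> real \<Rightarrow> 'a set" where
  "qball E d x r = {y \<in> E. d x y < r}"

definition qm_open :: "'a set \<Rightarrow> ('a \<Rightarrow> 'a \<Rightarrow> real) \<Rightarrow> 'a set \<Rightarrow> bool" where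
  "qm_open E d U \<longleftrightarrow> U \<subseteq> E \<and> (\<forall>x\<in>U. \<exists>r>0. qball E d x r \<subseteq> U)"

lemma istopology_qm_open: "istopology (qm_open E d)"
  unfolding istopology_def
proof (intro conjI allI impI ballI)
  fix S T assume S: "qm_open E d S" and T: "qm_open E d T"
  show "qm_open E d (S \<inter> T)"
    unfolding qm_open_def
  proof (intro conjI ballI)
    show "S \<inter> T \<subseteq> E" using S unfolding qm_open_def by blast
    fix x assume x: "x \<in> S \<inter> T"
    obtain r where r: "r > 0" "qball E d x r \<subseteq> S" using S x unfolding qm_open_def by blast
    obtain s where s: "s > 0" "qball E d x s \<subseteq> T" using T x unfolding qm_open_def by blast
    have "qball E d x (min r s) \<subseteq> S \<inter> T" using r s unfolding qball_def by auto
    then show "\<exists>r>0. qball E d x r \<subseteq> S \<inter> T" using r s by (intro exI[of _ "min r s"]) auto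
  qed
next
  fix K assume K: "\<forall>S\<in>K. qm_open E d S"
  show "qm_open E d (\<Union>K)"
    unfolding qm_open_def
  proof (intro conjI ballI)
    show "\<Union>K \<subseteq> E" using K unfolding qm_open_def by blast
    fix x assume "x \<in> \<Union>K"
    then obtain S where "S \<in> K" "x \<in> S" by blast
    then obtain r where "r > 0" "qball E d x r \<subseteq> S" using K unfolding qm_open_def by blast
    then show "\<exists>r>0. qball E d x r \<subseteq> \<Union>K" using \<open>S \<in> K\<close> by blast
  qed
qed

definition qm_topology :: "'a set \<Rightarrow> ('a \<Rightarrow> 'a \<Rightarrow> real) \<Rightarrow> 'a topology" where
  "qm_topology E d = topology (qm_open E d)"

definition qm_cauchy :: "('a \<Rightarrow> 'a \<Rightarrow> real) \<Rightarrow> (nat \<Rightarrow> 'a) \<Rightarrow> bool" where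
  "qm_cauchy d x \<longleftrightarrow>
     ((\<lambda>n. Sup (ereal ` {d (x n) (x p) | p. p \<ge> n})) \<longlonglongrightarrow> 0)"

definition qm_complete :: "'a set \<Rightarrow> ('a \<Rightarrow> 'a \<Rightarrow> real) \<Rightarrow> bool" where
  "qm_complete E d \<longleftrightarrow>
     (\<forall>x. (\<forall>n. x n \<in> E) \<and> qm_cauchy d x \<longrightarrow>
        (\<exists>y\<in>E. (\<lambda>n. max (d (x n) y) (d y (x n))) \<longlonglongrightarrow> 0))"

definition quasi_polish :: "'a topology \<Rightarrow> bool" where
  "quasi_polish X \<longleftrightarrow> second_countable X \<and>
     (\<exists>d. quasi_metric (topspace X) d \<and> qm_complete (topspace X) d \<and>
          qm_topology (topspace X) d = X)"

definition is_basis :: "'a topology \<Rightarrow> 'a set set \<Rightarrow> bool" where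
  "is_basis X \<B> \<longleftrightarrow> (\<forall>V\<in>\<B>. openin X V) \<and>
     (\<forall>U x. openin X U \<and> x \<in> U \<longrightarrow> (\<exists>V\<in>\<B>. x \<in> V \<and> V \<subseteq> U))"

definition approximation_relation ::
    "'a topology \<Rightarrow> 'a set set \<Rightarrow> ('a set \<Rightarrow> 'a set \<Rightarrow> bool) \<Rightarrow> bool" where
  "approximation_relation X \<B> R \<longleftrightarrow>
     (\<forall>U\<in>\<B>. \<forall>V\<in>\<B>. R U V \<longrightarrow> V \<subseteq> U) \<and>
     (\<forall>U\<in>\<B>. \<forall>V\<in>\<B>. \<forall>T\<in>\<B>. U \<subseteq> T \<and> R U V \<longrightarrow> R T V) \<and>
     (\<forall>U\<in>\<B>. \<forall>x\<in>U. \<exists>W\<in>\<B>. x \<in> W \<and> R U W) \<and>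
     (\<forall>Us::nat \<Rightarrow> 'a set. (\<forall>i. Us i \<in> \<B>) \<and> (\<forall>i. R (Us i) (Us (Suc i))) \<longrightarrow>
        (\<exists>x \<in> (\<Inter>i. Us i).
           \<forall>V. openin X V \<and> x \<in> V \<longrightarrow> (\<exists>i. Us i \<subseteq> V)))"

definition convergent_approximation_space :: "'a topology \<Rightarrow> bool" where
  "convergent_approximation_space X \<longleftrightarrow>
     (\<exists>\<B> R. is_basis X \<B> \<and> approximation_relation X \<B> R)"

end

theory Submission
  imports Defs
begin

text \<open>A formal ball is a pair \<open>(y, s)\<close> of a centre and a radius, and it lies strictly above
\<open>(y', s')\<close> if \<open>d y y' + s' < s\<close>. Completeness makes every strictly descending sequence of formal
balls with radii tending to \<open>0\<close> converge to a point lying in all of them. Second countability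
gives a countable family \<open>F\<close> of formal balls rich enough to interpolate everywhere; number it.
Declare \<open>T \<lless> V\<close> if for some \<open>x \<in> V\<close> there are \<open>c, b \<in> F\<close> with \<open>x \<in> c \<subseteq> T\<close> and \<open>V \<subseteq> b\<close>, such
that \<open>b\<close> is small and strictly below every ball of \<open>F\<close> that contains \<open>x\<close> and is numbered no
later than \<open>c\<close>. This makes no reference to how \<open>T\<close> was obtained as a ball. Along a sequence
for \<open>\<lless>\<close> either the indices of the balls \<open>c\<close> tend to infinity, and then each \<open>b\<close> is eventually
taken into account, which yields a strictly descending subsequence; or the same \<open>c\<close> recurs
infinitely often and the sequence of sets is eventually constant. To cover the second case,
\<open>b\<close> and \<open>c\<close> are allowed to be equal sets only if they form the least neighbourhood of \<open>x\<close>.\<close>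

section \<open>Balls and Cauchy sequences of a quasi-metric\<close>

lemma openin_qm_topology: "openin (qm_topology E d) = qm_open E d"
  unfolding qm_topology_def by (rule topology_inverse'[OF istopology_qm_open])

lemma quasi_metric_triangle:
  assumes "quasi_metric E d" "x \<in> E" "y \<in> E" "z \<in> E"
  shows "d x z \<le> d x y + d y z"
  using assms unfolding quasi_metric_def by blast

lemma quasi_metric_nonneg:
  assumes "quasi_metric E d" "x \<in> E" "y \<in> E"
  shows "0 \<le> d x y"
  using assms unfolding quasi_metric_def by blast

lemma quasi_metric_self:
  assumes "quasi_metric E d" "x \<in> E"
  shows "d x x = 0"
  using assms unfolding quasi_metric_def by blast

lemma qball_mono:
  assumes "quasi_metric E d" "x \<in> E" "y \<in> E" "d x y + s \<le> r"
  shows "qball E d y s \<subseteq> qball E d x r"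
proof
  fix z assume "z \<in> qball E d y s"
  then have "z \<in> E" "d y z < s" by (auto simp: qball_def)
  then show "z \<in> qball E d x r"
    using quasi_metric_triangle[OF assms(1,2,3), of z] assms(4) by (auto simp: qball_def)
qed

lemma qm_open_qball:
  assumes "quasi_metric E d" "x \<in> E"
  shows "qm_open E d (qball E d x r)"
  unfolding qm_open_def
proof (intro conjI ballI)
  show "qball E d x r \<subseteq> E" by (auto simp: qball_def)
  fix y assume "y \<in> qball E d x r"
  then have y: "y \<in> E" "d x y < r" by (auto simp: qball_def)
  then show "\<exists>e>0. qball E d y e \<subseteq> qball E d x r"
    using qball_mono[OF assms y(1), of "r - d x y" r] by (intro exI[of _ "r - d x y"]) auto
qed

lemma qm_cauchyI:
  assumes nonneg: "\<And>n p. n \<le> p \<Longrightarrow> 0 \<le> d (x n) (x p)"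
    and bound: "\<And>n p. n \<le> p \<Longrightarrow> d (x n) (x p) \<le> s n"
    and lim: "s \<longlonglongrightarrow> 0"
  shows "qm_cauchy d x"
  unfolding qm_cauchy_def
proof (rule tendsto_sandwich[OF _ _ tendsto_const])
  show "\<forall>\<^sub>F n in sequentially. 0 \<le> Sup (ereal ` {d (x n) (x p) |p. n \<le> p})"
  proof (intro always_eventually allI)
    fix n
    have "ereal (d (x n) (x n)) \<le> Sup (ereal ` {d (x n) (x p) |p. n \<le> p})"
      by (intro Sup_upper) auto
    then show "0 \<le> Sup (ereal ` {d (x n) (x p) |p. n \<le> p})"
      using nonneg[of n n] by (meson ereal_less_eq(5) le_refl order_trans)
  qed
  show "\<forall>\<^sub>F n in sequentially. Sup (ereal ` {d (x n) (x p) |p. n \<le> p}) \<le> ereal (s n)"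
    by (intro always_eventually allI Sup_least) (auto intro: bound)
  show "(\<lambda>n. ereal (s n)) \<longlonglongrightarrow> 0"
    using lim by (simp add: zero_ereal_def)
qed

text \<open>Telescoping the triangle inequality bounds the distance from a centre to every later one
  by the radius \<open>s n\<close>, so the centres form a Cauchy sequence. Its limit inherits this
  bound.\<close>

lemma descending_formal_balls_converge:
  assumes qm: "quasi_metric E d" and complete: "qm_complete E d"
    and y: "\<And>n. y n \<in> E"
    and descending: "\<And>n. d (y n) (y (Suc n)) + s (Suc n) < s n"
    and pos: "\<And>n. 0 < s n" and lim: "s \<longlonglongrightarrow> 0"
  obtains z where "z \<in> E" "\<And>n. d (y n) z < s n" "(\<lambda>n. d z (y n)) \<longlonglongrightarrow> 0"
proof -
  have chain: "d (y n) (y p) + s p \<le> s n" if "n \<le> p" for n p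
    using that
  proof (induction p rule: dec_induct)
    case base
    then show ?case using quasi_metric_self[OF qm y] by simp
  next
    case (step p)
    then show ?case
      using descending[of p] quasi_metric_triangle[OF qm y y y, of n "Suc p" p] by linarith
  qed
  have "qm_cauchy d y"
  proof (rule qm_cauchyI[OF _ _ lim])
    fix n p :: nat assume "n \<le> p"
    then show "d (y n) (y p) \<le> s n" using chain pos[of p] by fastforce
  qed (rule quasi_metric_nonneg[OF qm y y])
  then obtain z where z: "z \<in> E" and max: "(\<lambda>n. max (d (y n) z) (d z (y n))) \<longlonglongrightarrow> 0"
    using complete y unfolding qm_complete_def by blast
  have to: "(\<lambda>n. d (y n) z) \<longlonglongrightarrow> 0"
    by (rule tendsto_sandwich[OF _ _ tendsto_const max])
      (auto intro!: always_eventually quasi_metric_nonneg[OF qm] y z)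
  have from_z: "(\<lambda>n. d z (y n)) \<longlonglongrightarrow> 0"
    by (rule tendsto_sandwich[OF _ _ tendsto_const max])
      (auto intro!: always_eventually quasi_metric_nonneg[OF qm] y z)
  have le: "d (y n) z \<le> s n" for n
  proof (rule tendsto_lowerbound)
    show "(\<lambda>p. s n + d (y p) z) \<longlonglongrightarrow> s n"
      using tendsto_add[OF tendsto_const to, of "s n"] by simp
    show "\<forall>\<^sub>F p in sequentially. d (y n) z \<le> s n + d (y p) z"
      using eventually_ge_at_top[of n]
    proof eventually_elim
      case (elim p)
      then show ?case
        using chain[OF elim] pos[of p] quasi_metric_triangle[OF qm y y z, of n p] by linarith
    qed
  qed simp
  \<comment> \<open>Passing to the limit gives only a weak inequality; applying it at
    \<open>Suc n\<close> and using the strict descent from \<open>n\<close> restores strictness, so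
    \<open>z\<close> lies in the open balls.\<close>
  have "d (y n) z < s n" for n
    using descending[of n] le[of "Suc n"] quasi_metric_triangle[OF qm y y z, of n "Suc n"]
    by linarith
  then show thesis using that z from_z by blast
qed

text \<open>Two points of an open set contained in small balls around both of them are close in both
directions. So picking, for each basic open set and each radius, one such point of the set
gives a family that is countable and dense for the symmetrized metric.\<close>

lemma countable_formal_balls:
  fixes d :: "'a \<Rightarrow> 'a \<Rightarrow> real"
  assumes qm: "quasi_metric E d" and sc: "second_countable (qm_topology E d)"
  obtains F where "countable F" "\<And>y s. (y, s) \<in> F \<Longrightarrow> y \<in> E \<and> 0 < s"
    "\<And>x e. x \<in> E \<Longrightarrow> 0 < e \<Longrightarrow> \<exists>(y, s)\<in>F. s < e \<and> d y x < s \<and> d x y < s"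
proof -
  obtain \<B> where \<B>: "countable \<B>"
    and basis: "\<And>U x. qm_open E d U \<Longrightarrow> x \<in> U \<Longrightarrow> \<exists>V\<in>\<B>. x \<in> V \<and> V \<subseteq> U"
    using sc unfolding second_countable_def openin_qm_topology by metis
  define r where "r j = inverse (real (Suc j))" for j
  define P where "P V j y \<longleftrightarrow> y \<in> V \<and> y \<in> E \<and> V \<subseteq> qball E d y (r j)" for V j y
  define F where "F = {(SOME y. P V j y, r j) |V j. V \<in> \<B> \<and> (\<exists>y. P V j y)}"
  have "F \<subseteq> (\<lambda>(V, j). (SOME y. P V j y, r j)) ` (\<B> \<times> UNIV)"
    unfolding F_def by auto
  then have "countable F"
    by (rule countable_subset) (intro countable_image countable_SIGMA \<B> countableI_type)
  moreover have "y \<in> E \<and> 0 < s" if "(y, s) \<in> F" for y s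
  proof -
    obtain V j where *: "y = (SOME y. P V j y)" "s = r j" "\<exists>y. P V j y"
      using \<open>(y, s) \<in> F\<close> unfolding F_def by auto
    have "P V j y" using *(1) someI_ex[OF *(3)] by simp
    then show ?thesis using *(2) by (simp add: P_def r_def)
  qed
  moreover have "\<exists>(y, s)\<in>F. s < e \<and> d y x < s \<and> d x y < s" if x: "x \<in> E" and e: "0 < e" for x e
  proof -
    obtain j where j: "r j < e" using reals_Archimedean[OF e] unfolding r_def by blast
    have "x \<in> qball E d x (r j)"
      using x by (simp add: qball_def quasi_metric_self[OF qm] r_def)
    then obtain V where V: "V \<in> \<B>" "x \<in> V" "V \<subseteq> qball E d x (r j)"
      using basis[OF qm_open_qball[OF qm x]] by blast
    then have ex: "\<exists>y. P V j y" using x unfolding P_def by blast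
    define y where "y = (SOME y. P V j y)"
    have "P V j y" unfolding y_def by (rule someI_ex[OF ex])
    then have "d y x < r j" "d x y < r j" using V by (auto simp: P_def qball_def)
    moreover have "(y, r j) \<in> F" unfolding F_def y_def using V(1) ex by blast
    ultimately show ?thesis using j by auto
  qed
  ultimately show thesis using that by blast
qed

text \<open>Recurrent indices before and after \<open>j\<close> squeeze \<open>f j\<close> from
  above and below by \<open>a\<close>.\<close>

lemma decseq_recurrent_const:
  fixes f :: "nat \<Rightarrow> 'a :: order"
  assumes "decseq f" "infinite I" "\<And>i. i \<in> I \<Longrightarrow> a \<le> f i" "\<And>i. i \<in> I \<Longrightarrow> f (Suc i) \<le> a"
  shows "\<exists>i. \<forall>j\<ge>i. f j = a"
proof -
  obtain i where i: "i \<in> I" using assms(2) by fastforce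
  have "f j = a" if "Suc i \<le> j" for j
  proof (rule antisym)
    show "f j \<le> a" using order_trans[OF decseqD[OF assms(1) that] assms(4)[OF i]] .
    obtain k where k: "k \<in> I" "j < k" using assms(2) unfolding infinite_nat_iff_unbounded by blast
    show "a \<le> f j"
      using order_trans[OF assms(3)[OF k(1)] decseqD[OF assms(1) less_imp_le[OF k(2)]]] .
  qed
  then show ?thesis by blast
qed

theorem theorem3p6:
  fixes X :: "'a topology"
  assumes "quasi_polish X"
  shows "convergent_approximation_space X"
proof -
  define E where "E = topspace X"
  obtain d where sc: "second_countable X" and qm: "quasi_metric E d"
    and complete: "qm_complete E d" and X: "qm_topology E d = X"
    using assms unfolding quasi_polish_def E_def by blast
  have op: "openin X = qm_open E d" using openin_qm_topology X by metis
  obtain F where F: "countable F" and F_pos: "\<And>y s. (y, s) \<in> F \<Longrightarrow> y \<in> E \<and> 0 < s"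
    and dense: "\<And>x e. x \<in> E \<Longrightarrow> 0 < e \<Longrightarrow> \<exists>(y, s)\<in>F. s < e \<and> d y x < s \<and> d x y < s"
    by (rule countable_formal_balls[OF qm, unfolded X, OF sc]) blast
  have F_in: "fst b \<in> E" "0 < snd b" if "b \<in> F" for b
    using F_pos[of "fst b" "snd b"] that by auto
  define idx where "idx = to_nat_on F"
  have idx: "inj_on idx F" unfolding idx_def by (rule inj_on_to_nat_on[OF F])
  define ball where "ball b = qball E d (fst b) (snd b)" for b
  define above where "above k b \<longleftrightarrow> d (fst k) (fst b) + snd b < snd k" for k b
  have ball_above: "ball b \<subseteq> ball k" if "above k b" "k \<in> F" "b \<in> F" for k b
    using that unfolding above_def ball_def by (intro qball_mono[OF qm]) (auto simp: F_in)
  have interpolate: "\<exists>b\<in>F. x \<in> ball b \<and> ball b \<subseteq> U \<and> snd b < e \<and> (\<forall>k\<in>K. above k b)"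
    if U: "qm_open E d U" "x \<in> U" and e: "0 < e"
      and K: "finite K" "K \<subseteq> F" "\<forall>k\<in>K. x \<in> ball k" for x U e K
  proof -
    have x: "x \<in> E" using U unfolding qm_open_def by blast
    obtain r where r: "0 < r" "qball E d x r \<subseteq> U" using U unfolding qm_open_def by blast
    \<comment> \<open>The least slack at \<open>x\<close>: the room inside \<open>U\<close>, the
      bound \<open>e\<close>, and the room that each ball of \<open>K\<close> leaves around
      \<open>x\<close>.\<close>
    define m where "m = Min ({r, e} \<union> (\<lambda>k. snd k - d (fst k) x) ` K)"
    have m: "m \<le> r" "m \<le> e" "\<And>k. k \<in> K \<Longrightarrow> m \<le> snd k - d (fst k) x"
      using K(1) unfolding m_def by - (rule Min_le; simp)+
    have "0 < m"
      unfolding m_def using K(1,3) r(1) e by (subst Min_gr_iff) (auto simp: ball_def qball_def)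
    \<comment> \<open>One half of \<open>m\<close> pays for the distance from \<open>x\<close> to
      \<open>y\<close>, the other for the radius \<open>s\<close>.\<close>
    then obtain y s where b: "(y, s) \<in> F" "s < m / 2" "d y x < s" "d x y < s"
      using dense[OF x, of "m / 2"] by auto
    have y: "y \<in> E" "0 < s" using F_pos[OF b(1)] by auto
    have "ball (y, s) \<subseteq> qball E d x r"
      unfolding ball_def using b m(1) by (intro qball_mono[OF qm x]) (auto simp: y)
    moreover have "above k (y, s)" if k: "k \<in> K" for k
      using quasi_metric_triangle[OF qm F_in(1) x y(1), of k] K(2) k m(3)[OF k] b
      unfolding above_def by auto
    ultimately show ?thesis
      using b y x r(2) m(2) by (intro bexI[of _ "(y, s)"]) (auto simp: ball_def qball_def)
  qed

  \<comment> \<open>The approximation relation on the open sets\<close>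
  define \<B> where "\<B> = {U. openin X U}"
  define link where "link x c b \<longleftrightarrow> c \<in> F \<and> b \<in> F \<and> x \<in> ball c \<and>
      (\<forall>k\<in>F. idx k \<le> idx c \<and> x \<in> ball k \<longrightarrow> above k b) \<and>
      snd b < inverse (real (Suc (idx c))) \<and>
      (ball b = ball c \<longrightarrow> (\<forall>W. openin X W \<and> x \<in> W \<longrightarrow> ball c \<subseteq> W))" for x c b
  define R where "R T V \<longleftrightarrow> (\<exists>x c b. link x c b \<and> x \<in> V \<and> V \<subseteq> ball b \<and> ball c \<subseteq> T)" for T V
  \<comment> \<open>The case \<open>k = c\<close> of the clause on earlier balls gives
    \<open>above c b\<close>.\<close>
  have link_ball: "ball b \<subseteq> ball c" if "link x c b" for x c b
    using ball_above that unfolding link_def by blast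
  have open_ball: "openin X (ball b)" if "b \<in> F" for b
    unfolding op ball_def using F_in(1)[OF that] by (rule qm_open_qball[OF qm])
  have shrink: "R U V \<Longrightarrow> V \<subseteq> U" for U V
    unfolding R_def using link_ball by blast
  have upward: "U \<subseteq> T \<Longrightarrow> R U V \<Longrightarrow> R T V" for U V T
    unfolding R_def by blast
  have refine: "\<exists>W\<in>\<B>. x \<in> W \<and> R U W" if U: "U \<in> \<B>" and x: "x \<in> U" for U x
  proof -
    obtain c where c: "c \<in> F" "x \<in> ball c" "ball c \<subseteq> U"
      using interpolate[of U x 1 "{}"] U x by (auto simp: \<B>_def op)
    \<comment> \<open>If some open set around \<open>x\<close> fails to contain
      \<open>ball c\<close>, placing \<open>b\<close> inside it forces \<open>ball b\<close> and
      \<open>ball c\<close> to differ. Otherwise \<open>ball c\<close> is the least neighbourhood of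
      \<open>x\<close>, and any \<open>W\<close> will do.\<close>
    obtain W where W: "openin X W" "x \<in> W"
      and least: "ball c \<subseteq> W \<Longrightarrow> \<forall>W. openin X W \<and> x \<in> W \<longrightarrow> ball c \<subseteq> W"
    proof (cases "\<exists>W. openin X W \<and> x \<in> W \<and> \<not> ball c \<subseteq> W")
      case True
      then show thesis using that by blast
    next
      case False
      then show thesis using that[of U] U x unfolding \<B>_def by blast
    qed
    define K where "K = {k \<in> F. idx k \<le> idx c \<and> x \<in> ball k}"
    have "finite (idx ` K)" by (rule finite_subset[of _ "{..idx c}"]) (auto simp: K_def)
    then have "finite K"
      by (rule finite_imageD) (auto intro: inj_on_subset[OF idx] simp: K_def)
    then have "\<exists>b\<in>F. x \<in> ball b \<and> ball b \<subseteq> W \<and> snd b < inverse (real (Suc (idx c)))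
        \<and> (\<forall>k\<in>K. above k b)"
      using W by (intro interpolate) (auto simp: K_def op)
    then obtain b where b: "b \<in> F" "x \<in> ball b" "ball b \<subseteq> W"
      "snd b < inverse (real (Suc (idx c)))" "\<forall>k\<in>K. above k b" by blast
    have "link x c b"
      unfolding link_def
    proof (intro conjI)
      show "\<forall>k\<in>F. idx k \<le> idx c \<and> x \<in> ball k \<longrightarrow> above k b"
        using b(5) unfolding K_def by blast
      show "ball b = ball c \<longrightarrow> (\<forall>W. openin X W \<and> x \<in> W \<longrightarrow> ball c \<subseteq> W)"
        using b(3) least by metis
    qed (use b c in blast)+
    then have "R U (ball b)" unfolding R_def using b(2) c(3) by blast
    then show ?thesis using b(2) open_ball[OF b(1)] unfolding \<B>_def by blast
  qed

  \<comment> \<open>Convergence along chains of the relation\<close>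
  have converge: "\<exists>z \<in> (\<Inter>i. Us i). \<forall>V. openin X V \<and> z \<in> V \<longrightarrow> (\<exists>i. Us i \<subseteq> V)"
    if Us: "\<forall>i. R (Us i) (Us (Suc i))" for Us :: "nat \<Rightarrow> 'a set"
  proof -
    obtain x c b where link: "\<And>i. link (x i) (c i) (b i)" and x: "\<And>i. x i \<in> Us (Suc i)"
      and Us_b: "\<And>i. Us (Suc i) \<subseteq> ball (b i)" and c_Us: "\<And>i. ball (c i) \<subseteq> Us i"
      using Us unfolding R_def by metis
    have bF: "b i \<in> F" and cF: "c i \<in> F" for i using link unfolding link_def by blast+
    have dec: "decseq Us"
      using Us_b link_ball[OF link] c_Us by (intro decseq_SucI) blast
    show ?thesis
    proof (cases "\<exists>i. \<forall>j\<ge>i. Us j = Us i")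
      case True
      then obtain i where i: "\<And>j. i \<le> j \<Longrightarrow> Us j = Us i" by blast
      \<comment> \<open>Constancy collapses the inclusions \<open>Us (Suc i) \<subseteq> ball (b i)
        \<subseteq> ball (c i) \<subseteq> Us i\<close>, so the equality clause of
        \<open>link\<close> makes \<open>Us i\<close> the least neighbourhood of
        \<open>x i\<close>.\<close>
      have eq: "ball (b i) = Us i" "ball (c i) = Us i"
        using Us_b[of i] link_ball[OF link, of i] c_Us[of i] i[of "Suc i"] by auto
      have "x i \<in> Us j" for j
        using x[of i] decseqD[OF dec, of j "Suc i"] i[of j] i[of "Suc i"] by (cases "j \<le> i") auto
      moreover have "Us i \<subseteq> V" if "openin X V" "x i \<in> V" for V
        using link[of i] eq that unfolding link_def by simp
      ultimately show ?thesis by blast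
    next
      case False
      have fin: "finite {i. idx (c i) = n}" for n
      proof (rule ccontr)
        assume inf: "infinite {i. idx (c i) = n}"
        then obtain i0 where i0: "idx (c i0) = n" using not_finite_existsD by blast
        have same: "c i = c i0" if "idx (c i) = n" for i
          using inj_onD[OF idx _ cF cF] that i0 by metis
        have "\<exists>i. \<forall>j\<ge>i. Us j = ball (c i0)"
        proof (rule decseq_recurrent_const[OF dec inf])
          fix i assume "i \<in> {i. idx (c i) = n}"
          then have "c i = c i0" using same by blast
          then show "ball (c i0) \<subseteq> Us i" "Us (Suc i) \<subseteq> ball (c i0)"
            using c_Us[of i] Us_b[of i] link_ball[OF link, of i] by auto
        qed
        then show False using False by (metis order_refl)
      qed
      have large: "\<exists>j>i. n \<le> idx (c j)" for i n
      proof -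
        have "finite (\<Union>k\<in>{..<n}. {i. idx (c i) = k})" using fin by blast
        then have "finite ({..i} \<union> (\<Union>k\<in>{..<n}. {i. idx (c i) = k}))" by blast
        then obtain j where "j \<notin> {..i} \<union> (\<Union>k\<in>{..<n}. {i. idx (c i) = k})"
          using ex_new_if_finite[OF infinite_UNIV_nat] by blast
        then show ?thesis by (intro exI[of _ j]) auto
      qed
      \<comment> \<open>Since the sets decrease, \<open>x j\<close> still lies in
        \<open>ball (b i)\<close>, which is thus among the balls that \<open>link\<close> puts above
        \<open>b j\<close>.\<close>
      have later_above: "above (b i) (b j)" if "i < j" "idx (b i) \<le> idx (c j)" for i j
      proof -
        have "x j \<in> ball (b i)"
          using x[of j] Us_b[of i] decseqD[OF dec, of "Suc i" "Suc j"] that(1) by auto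
        then show ?thesis using link[of j] bF[of i] that(2) unfolding link_def by blast
      qed
      have "\<exists>g. \<forall>l. l \<le> idx (c (g l)) \<and> (g l < g (Suc l) \<and> above (b (g l)) (b (g (Suc l))))"
      proof (rule dependent_nat_choice)
        show "\<exists>i. 0 \<le> idx (c i)" by simp
        fix i l
        \<comment> \<open>The bound \<open>Suc l\<close> will drive the radii to \<open>0\<close>;
          the bound \<open>idx (b i)\<close> brings \<open>b i\<close> into the scope of
          \<open>link\<close> at stage \<open>j\<close>.\<close>
        obtain j where "i < j" "max (Suc l) (idx (b i)) \<le> idx (c j)" using large by blast
        then show "\<exists>j. Suc l \<le> idx (c j) \<and> i < j \<and> above (b i) (b j)"
          using later_above[of i j] by auto
      qed
      then obtain g where g: "\<And>l. l \<le> idx (c (g l))" "\<And>l. g l < g (Suc l)"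
        "\<And>l. above (b (g l)) (b (g (Suc l)))" by blast
      have g_mono: "strict_mono g" using g(2) by (simp add: strict_mono_Suc_iff)
      have radius: "(\<lambda>l. snd (b (g l))) \<longlonglongrightarrow> 0"
      proof (rule tendsto_sandwich[OF _ _ tendsto_const LIMSEQ_inverse_real_of_nat])
        show "\<forall>\<^sub>F l in sequentially. 0 \<le> snd (b (g l))"
          using F_in(2)[OF bF] by (simp add: less_imp_le)
        have "snd (b (g l)) \<le> inverse (real (Suc l))" for l
        proof -
          have "snd (b (g l)) < inverse (real (Suc (idx (c (g l)))))"
            using link[of "g l"] unfolding link_def by blast
          also have "\<dots> \<le> inverse (real (Suc l))" using g(1)[of l] by (intro le_imp_inverse_le) auto
          finally show ?thesis by simp
        qed
        then show "\<forall>\<^sub>F l in sequentially. snd (b (g l)) \<le> inverse (real (Suc l))" by simp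
      qed
      obtain z where z: "z \<in> E" "\<And>l. d (fst (b (g l))) z < snd (b (g l))"
        and lim: "(\<lambda>l. d z (fst (b (g l)))) \<longlonglongrightarrow> 0"
        using descending_formal_balls_converge[OF qm complete,
            of "\<lambda>l. fst (b (g l))" "\<lambda>l. snd (b (g l))"]
          F_in[OF bF] g(3) radius unfolding above_def by blast
      have "z \<in> Us i" for i
      proof -
        have "z \<in> ball (b (g i))" using z by (simp add: ball_def qball_def)
        then have "z \<in> Us (g i)" using link_ball[OF link] c_Us by blast
        then show ?thesis using decseqD[OF dec] seq_suble[OF g_mono, of i] by blast
      qed
      moreover have "\<exists>i. Us i \<subseteq> V" if V: "openin X V" "z \<in> V" for V
      proof -
        obtain r where r: "0 < r" "qball E d z r \<subseteq> V" using V unfolding op qm_open_def by blast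
        \<comment> \<open>Neighbourhoods of \<open>z\<close> are measured by distances from
          \<open>z\<close>, so convergence in this direction is what fits the small balls into
          \<open>V\<close>.\<close>
        have "(\<lambda>l. d z (fst (b (g l))) + snd (b (g l))) \<longlonglongrightarrow> 0"
          using tendsto_add[OF lim radius] by simp
        then have "\<forall>\<^sub>F l in sequentially. d z (fst (b (g l))) + snd (b (g l)) < r"
          using r(1) by (rule order_tendstoD)
        then obtain l where "d z (fst (b (g l))) + snd (b (g l)) < r"
          using eventually_happens'[OF sequentially_bot] by blast
        then have "ball (b (g l)) \<subseteq> qball E d z r"
          unfolding ball_def using F_in(1)[OF bF] by (intro qball_mono[OF qm z(1)]) auto
        then show ?thesis using Us_b r(2) by blast
      qed
      ultimately show ?thesis by blast
    qed
  qed
  have "approximation_relation X \<B> R"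
    unfolding approximation_relation_def
    by (intro conjI ballI allI impI; (elim conjE)?)
      (erule shrink, erule (1) upward, erule (1) refine, erule converge)
  moreover have "is_basis X \<B>" unfolding is_basis_def \<B>_def by blast
  ultimately show ?thesis unfolding convergent_approximation_space_def by blast
qed

end
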